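(* For every real number $\varepsilon>0$ there is a constant $k_{\varepsilon}>0$, depending only on $\varepsilon$, such that for every integer $c\ge 3$ $$G_{c}^{\frac{2}{\varphi(c)}} > k_{\varepsilon}\,R(c)^{1-\varepsilon}\,c^{2}.$$
   Context: For a positive integer $n$, $R(n)$ denotes its radical, i.e. the product of the distinct primes dividing $n$ (with $R(1)=1$), and $\varphi$ is Euler's totient function. For an integer $c\ge 3$, the equation $x+y=c$ in positive integers with $\gcd(x,y)=1$ and $x<y$ has exactly $\varphi(c)/2$ solutions; denote them $(a_i,b_i)$, $1\le i\le \varphi(c)/2$. Define $$G_c=\prod_{1\le i\le \varphi(c)/2} R(a_i b_i c).$$ Thus $G_c^{2/\varphi(c)}$ is the geometric mean of the radicals $R(a_ib_ic)$. *)

theory Defs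
  imports Complex_Main "HOL-Number_Theory.Totient"
begin

definition rad :: "nat \<Rightarrow> nat" where
  "rad n = \<Prod>(prime_factors n)"

definition abc_pairs :: "nat \<Rightarrow> (nat \<times> nat) set" where
  "abc_pairs c = {(a, b). 0 < a \<and> 0 < b \<and> coprime a b \<and> a < b \<and> a + b = c}"

definition G :: "nat \<Rightarrow> nat" where
  "G c = (\<Prod>(a, b)\<in>abc_pairs c. rad (a * b * c))"

lemma finite_abc_pairs: "finite (abc_pairs c)"
  by (rule finite_subset[of _ "{..c} \<times> {..c}"]) (auto simp: abc_pairs_def)

lemma totient_eq_card_abc_pairs:
  assumes "c \<ge> 3"
  shows "totient c = 2 * card (abc_pairs c)"
proof -
  have cop1: "coprime a (a + b) \<longleftrightarrow> coprime a b" for a b :: nat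
    by (simp only: coprime_iff_gcd_eq_1 gcd_add2)
  have cop2: "coprime b (a + b) \<longleftrightarrow> coprime a b" for a b :: nat
    by (subst add.commute, subst cop1, rule coprime_commute)
  have "totatives c = fst ` abc_pairs c \<union> snd ` abc_pairs c"
  proof (intro equalityI subsetI)
    fix x assume x: "x \<in> totatives c"
    have "x < c"
      using totatives_less[OF x] assms by simp
    then obtain y where y: "c = x + y" "y > 0"
      by (metis less_imp_add_positive)
    have "x > 0" "coprime x (x + y)"
      using x by (simp_all add: totatives_def y(1))
    then have cop: "coprime x y" "coprime y x"
      by (simp_all only: cop1 coprime_commute[of y x])
    have "x \<noteq> y"
    proof
      assume "x = y"
      with cop have "x = 1" by simp
      with \<open>x = y\<close> y assms show False by simp
    qed
    then have "x < y \<or> y < x"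
      by linarith
    with cop y \<open>x > 0\<close> have "(x, y) \<in> abc_pairs c \<or> (y, x) \<in> abc_pairs c"
      by (auto simp: abc_pairs_def)
    then show "x \<in> fst ` abc_pairs c \<union> snd ` abc_pairs c"
      by force
  qed (auto simp: abc_pairs_def totatives_def cop1 cop2)
  moreover have "fst ` abc_pairs c \<inter> snd ` abc_pairs c = {}"
    by (auto simp: abc_pairs_def)
  moreover have "inj_on fst (abc_pairs c)" "inj_on snd (abc_pairs c)"
    by (auto simp: abc_pairs_def inj_on_def)
  ultimately show ?thesis
    by (simp add: totient_def card_Un_disjoint finite_abc_pairs card_image)
qed

end

theory Submission
  imports Defs "HOL-Computational_Algebra.Squarefree" "HOL-Analysis.Summation_Tests"
begin

text \<open>
  Taking logarithms, the theorem asks for a lower bound on the average of \<open>ln (rad m)\<close> over the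
  totatives \<open>m\<close> of \<open>c\<close>. The defect \<open>ln c - ln (rad m)\<close> is nonnegative for every \<open>m \<le> c\<close>, so its
  sum over the totatives is at most its sum over all \<open>m \<le> c\<close>, and the latter is \<open>O(c)\<close>: Stirling
  bounds the sum of \<open>ln c - ln m\<close>, and \<open>m / rad m\<close> is at most the largest square dividing \<open>m\<close>,
  whose logarithm is bounded on average. Averaging over totatives therefore loses \<open>O(c / \<phi>(c))\<close>.
  Here \<open>c / \<phi>(c) \<le> \<omega>(c) + 1\<close>, where \<open>\<omega>(c)\<close> counts the primes dividing \<open>c\<close>, and this is at most
  \<open>C + \<delta> ln (rad c)\<close> for every \<open>\<delta> > 0\<close> because all but boundedly many primes dividing \<open>c\<close> contribute
  a large logarithm to \<open>ln (rad c)\<close>.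
\<close>

section \<open>Radicals and square parts\<close>

lemma prime_factors_ge_2: "p \<in> prime_factors n \<Longrightarrow> p \<ge> (2 :: nat)"
  by (simp add: in_prime_factors_iff prime_ge_2_nat)

lemma rad_pos: "rad n > 0"
  unfolding rad_def by (intro prod_pos) (use prime_factors_ge_2 in force)

lemma rad_mult_coprime:
  assumes "coprime a b" "a > 0" "b > 0"
  shows "rad (a * b) = rad a * rad b"
proof -
  have "prime_factors (a * b) = prime_factors a \<union> prime_factors b"
    using assms by (simp add: prime_factors_product)
  moreover have "prime_factors a \<inter> prime_factors b = {}"
    using assms(1) by (meson coprime_common_divisor disjoint_iff in_prime_factors_iff not_prime_unit)
  ultimately show ?thesis
    unfolding rad_def by (simp add: prod.union_disjoint)
qed

lemma rad_le:
  assumes "n > 0"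
  shows "rad n \<le> n"
proof -
  have "rad n \<le> (\<Prod>p\<in>prime_factors n. p ^ multiplicity p n)"
    unfolding rad_def
    by (intro prod_mono) (auto simp: prime_factors_multiplicity Suc_le_eq prime_gt_0_nat
        intro!: self_le_power)
  also have "\<dots> = n"
    using prime_factorization_nat[OF assms] by simp
  finally show ?thesis .
qed

text \<open>The squarefree part of \<open>n\<close> has all exponents 1, so it is the product of its
  own primes; these divide \<open>n\<close>, so this product divides \<open>rad n\<close>.\<close>

lemma le_rad_mult_square_part:
  assumes "n > 0"
  shows "n \<le> rad n * square_part n ^ 2"
proof -
  let ?q = "squarefree_part n"
  have n: "n = ?q * square_part n ^ 2"
    by (rule squarefree_decompose)
  have q: "?q > 0"
    by (simp add: zero_less_iff_neq_zero)
  have "?q = (\<Prod>p\<in>prime_factors ?q. p ^ multiplicity p ?q)"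
    using prime_factorization_nat[OF q] by simp
  also have "\<dots> = \<Prod>(prime_factors ?q)"
    using q squarefree_factorial_semiring'[of ?q] by (intro prod.cong) auto
  also have "\<dots> \<le> rad n"
    unfolding rad_def
  proof (rule dvd_imp_le)
    have "?q dvd n"
      using n by (metis dvd_triv_left)
    then have "prime_factors ?q \<subseteq> prime_factors n"
      using assms by (intro dvd_prime_factors) auto
    then show "\<Prod>(prime_factors ?q) dvd \<Prod>(prime_factors n)"
      by (intro prod_dvd_prod_subset) auto
  qed (use rad_pos[of n] in \<open>simp add: rad_def\<close>)
  finally show ?thesis
    using n by (metis mult_le_mono1)
qed

section \<open>Sums of logarithms over \<open>{1..n}\<close>\<close>

lemma sum_ln_ge: "(\<Sum>m=1..n. ln (real m)) \<ge> real n * ln (real n) - real n"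
proof (induction n)
  case (Suc n)
  show ?case
  proof (cases "n = 0")
    case False
    \<comment> \<open>After cancelling \<open>ln (Suc n)\<close>, the induction step amounts to
      \<open>n * (ln (n + 1) - ln n) \<le> 1\<close>.\<close>
    have "ln (real (Suc n)) - ln (real n) = ln (1 + 1 / real n)"
      using False ln_div[of "real (Suc n)" "real n"] by (simp add: add_divide_distrib add.commute)
    also have "\<dots> \<le> 1 / real n"
      by (intro ln_add_one_self_le_self) simp
    finally have "real n * (ln (real (Suc n)) - ln (real n)) \<le> 1"
      using False by (simp add: field_simps)
    with Suc show ?thesis
      by (simp add: algebra_simps)
  qed simp
qed simp

lemma card_multiples_le:
  assumes "d > 0"
  shows "card {m\<in>{1..n}. d dvd m} \<le> n div d"
proof -
  have "{m\<in>{1..n}. d dvd m} \<subseteq> (\<lambda>k. d * k) ` {1..n div d}"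
  proof
    fix m assume m: "m \<in> {m\<in>{1..n}. d dvd m}"
    then obtain k where k: "m = d * k" by auto
    with m assms have "k \<ge> 1" "k \<le> n div d"
      by (auto simp: less_eq_div_iff_mult_less_eq mult.commute Suc_le_eq)
    with k show "m \<in> (\<lambda>k. d * k) ` {1..n div d}" by auto
  qed
  then have "card {m\<in>{1..n}. d dvd m} \<le> card {1..n div d}"
    by (rule surj_card_le[rotated]) simp
  then show ?thesis by simp
qed

text \<open>Since \<open>ln n\<close> is at most twice the square root of \<open>n\<close>, the
  terms are dominated by a convergent power series with exponent -3/2.\<close>

lemma summable_ln_over_square: "summable (\<lambda>n. ln (real n) / real n ^ 2)"
proof (rule summable_comparison_test)
  show "summable (\<lambda>n. 2 * real n powr (-3/2))"
    by (intro summable_mult) (subst summable_real_powr_iff, simp)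
  have "norm (ln (real n) / real n ^ 2) \<le> 2 * real n powr (-3/2)" if "n \<ge> 1" for n
  proof -
    have "ln (real n) \<le> 2 * real n powr (1/2)"
      using ln_powr_bound[of "real n" "1/2"] that by simp
    then have "ln (real n) / real n ^ 2 \<le> 2 * real n powr (1/2) / real n powr 2"
      using that by (simp add: divide_right_mono)
    also have "\<dots> = 2 * real n powr (1/2 - 2)"
      by (subst powr_diff) simp
    finally show ?thesis
      using that by simp
  qed
  then show "\<exists>N. \<forall>n\<ge>N. norm (ln (real n) / real n ^ 2) \<le> 2 * real n powr (-3/2)"
    by blast
qed

text \<open>Replacing the square part by all \<open>d\<close> with \<open>d ^ 2 dvd m\<close> allows
  swapping the sums; at most \<open>n / d ^ 2\<close> numbers up to \<open>n\<close> are multiples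
  of \<open>d ^ 2\<close>.\<close>

lemma sum_ln_square_part_le:
  "(\<Sum>m=1..n. ln (real (square_part m))) \<le> real n * (\<Sum>d. ln (real d) / real d ^ 2)"
proof -
  have "ln (real (square_part m)) \<le> (\<Sum>d=1..n. if d ^ 2 dvd m then ln (real d) else 0)"
    if m: "m \<in> {1..n}" for m
  proof -
    let ?s = "square_part m"
    \<comment> \<open>The square part is itself one of the \<open>d\<close> in the sum, and the
      other terms are nonnegative.\<close>
    have s: "?s ^ 2 dvd m" by simp
    have "?s dvd m"
      using s by (meson dvd_power dvd_trans zero_less_numeral)
    then have "?s \<le> n"
      using m dvd_imp_le[of ?s m] by auto
    moreover have "?s \<noteq> 0"
      using m by simp
    ultimately have "?s \<in> {1..n}" unfolding atLeastAtMost_iff by linarith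
    then have "(if ?s ^ 2 dvd m then ln (real ?s) else 0) \<le> (\<Sum>d=1..n. if d ^ 2 dvd m then ln (real d) else 0)"
      by (intro member_le_sum) auto
    with s show ?thesis by simp
  qed
  then have "(\<Sum>m=1..n. ln (real (square_part m)))
      \<le> (\<Sum>m=1..n. \<Sum>d=1..n. if d ^ 2 dvd m then ln (real d) else 0)"
    by (rule sum_mono)
  also have "\<dots> = (\<Sum>d=1..n. \<Sum>m=1..n. if d ^ 2 dvd m then ln (real d) else 0)"
    by (rule sum.swap)
  also have "\<dots> = (\<Sum>d=1..n. real (card {m\<in>{1..n}. d ^ 2 dvd m}) * ln (real d))"
    by (simp add: sum.If_cases Int_def)
  also have "\<dots> \<le> (\<Sum>d=1..n. (real n / real d ^ 2) * ln (real d))"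
  proof (intro sum_mono mult_right_mono)
    fix d assume d: "d \<in> {1..n}"
    have "real (card {m\<in>{1..n}. d ^ 2 dvd m}) \<le> real (n div d ^ 2)"
      using d by (intro of_nat_mono card_multiples_le) auto
    also have "\<dots> \<le> real n / real (d ^ 2)"
      by (rule of_nat_div_le_of_nat)
    finally show "real (card {m\<in>{1..n}. d ^ 2 dvd m}) \<le> real n / real d ^ 2"
      by simp
  qed auto
  also have "\<dots> = real n * (\<Sum>d=1..n. ln (real d) / real d ^ 2)"
    by (simp add: sum_distrib_left)
  also have "(\<Sum>d=1..n. ln (real d) / real d ^ 2) \<le> (\<Sum>d. ln (real d) / real d ^ 2)"
  \<comment> \<open>The series starts at \<open>d = 0\<close>, where division by zero makes the term
    0.\<close>
  proof (intro sum_le_suminf summable_ln_over_square)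
    show "0 \<le> ln (real d) / real d ^ 2" for d
      by (cases "d = 0") auto
  qed auto
  finally show ?thesis
    by (simp add: mult_left_mono)
qed

text \<open>The Stirling bound contributes 1 to the constant; the square part enters squared, hence
  twice the value of the series.\<close>

lemma sum_rad_defect_le:
  "\<exists>K\<ge>0. \<forall>n. (\<Sum>m=1..n. ln (real n) - ln (real (rad m))) \<le> K * real n"
proof (intro exI conjI allI)
  let ?S = "\<Sum>d. ln (real d) / real d ^ 2"
  have "?S \<ge> 0"
  proof (intro suminf_nonneg summable_ln_over_square)
    show "0 \<le> ln (real d) / real d ^ 2" for d
      by (cases "d = 0") auto
  qed
  then show "1 + 2 * ?S \<ge> 0" by simp
  fix n
  have "ln (real m) \<le> ln (real (rad m)) + 2 * ln (real (square_part m))" if "m \<in> {1..n}" for m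
  proof -
    have s: "square_part m \<noteq> 0"
      using that by simp
    have "real m \<le> real (rad m * square_part m ^ 2)"
      using that by (intro of_nat_mono le_rad_mult_square_part) auto
    then have "ln (real m) \<le> ln (real (rad m) * real (square_part m) ^ 2)"
      using that s rad_pos[of m] by (subst ln_le_cancel_iff) auto
    also have "\<dots> = ln (real (rad m)) + 2 * ln (real (square_part m))"
      using that s rad_pos[of m] by (subst ln_mult) (auto simp: ln_realpow)
    finally show ?thesis .
  qed
  then have "(\<Sum>m=1..n. ln (real m))
      \<le> (\<Sum>m=1..n. ln (real (rad m)) + 2 * ln (real (square_part m)))"
    by (rule sum_mono)
  also have "\<dots> = (\<Sum>m=1..n. ln (real (rad m))) + 2 * (\<Sum>m=1..n. ln (real (square_part m)))"
    by (simp add: sum.distrib sum_distrib_left)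
  finally have "(\<Sum>m=1..n. ln (real (rad m))) \<ge> real n * ln (real n) - real n - 2 * (real n * ?S)"
    using sum_ln_ge[of n] sum_ln_square_part_le[of n] by linarith
  then show "(\<Sum>m=1..n. ln (real n) - ln (real (rad m))) \<le> (1 + 2 * ?S) * real n"
    by (simp add: sum_subtractf algebra_simps)
qed

section \<open>Bounding \<open>c / totient c\<close> by the number of primes and by
  \<open>rad c\<close>\<close>

lemma prod_one_minus_inverse_ge:
  fixes A :: "nat set"
  assumes "finite A" "\<And>x. x \<in> A \<Longrightarrow> x \<ge> 2"
  shows "(\<Prod>x\<in>A. 1 - 1 / real x) \<ge> 1 / (real (card A) + 1)"
  using assms
proof (induction A rule: finite_linorder_max_induct)
  case (insert b A)
  let ?k = "real (card A)"
  \<comment> \<open>As \<open>b\<close> exceeds all of \<open>A\<close>, it is at least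
    \<open>card A + 2\<close>. The extremal set is \<open>{2..k+1}\<close>, whose product telescopes
    to \<open>1 / (k + 1)\<close>.\<close>
  have "A \<subseteq> {2..<b}"
    using insert by force
  then have "card A \<le> b - 2"
    using card_mono[of "{2..<b}" A] by simp
  moreover have "b \<ge> 2"
    using insert.prems by simp
  ultimately have b: "real b \<ge> ?k + 2" by linarith
  have "1 / (?k + 2) = (1 - 1 / (?k + 2)) * (1 / (?k + 1))"
    by (simp add: divide_simps)
  also have "\<dots> \<le> (1 - 1 / real b) * (\<Prod>x\<in>A. 1 - 1 / real x)"
    using b insert by (intro mult_mono) (auto simp: field_simps)
  finally show ?case
    using insert.hyps by (subst prod.insert; force simp: add_ac)
qed simp

lemma div_totient_le:
  assumes "c > 0"
  shows "real c / real (totient c) \<le> real (card (prime_factors c)) + 1"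
proof -
  let ?w = "real (card (prime_factors c)) + 1"
  have "1 / ?w \<le> (\<Prod>p\<in>prime_factors c. 1 - 1 / real p)"
    by (intro prod_one_minus_inverse_ge) (auto dest: prime_factors_ge_2)
  then have "real c * (1 / ?w) \<le> real (totient c)"
    unfolding totient_formula2 by (intro mult_left_mono) auto
  then show ?thesis
    using assms by (simp add: field_simps)
qed

text \<open>Fewer than \<open>T\<close> primes lie below \<open>T\<close>, and each remaining prime
  contributes at least \<open>ln T\<close> to \<open>ln (rad c)\<close>.\<close>

lemma card_prime_factors_le:
  assumes "T \<ge> 2"
  shows "real (card (prime_factors c)) \<le> real T + ln (real (rad c)) / ln (real T)"
proof -
  let ?P = "prime_factors c"
  have lnT: "ln (real T) > 0"
    using assms by simp
  have "card ?P \<le> card ({..<T} \<union> {p\<in>?P. T \<le> p})"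
    by (intro card_mono) auto
  also have "\<dots> \<le> T + card {p\<in>?P. T \<le> p}"
    using card_Un_le[of "{..<T}"] by simp
  finally have "real (card ?P) \<le> real T + real (card {p\<in>?P. T \<le> p})"
    by linarith
  moreover have "real (card {p\<in>?P. T \<le> p}) * ln (real T) \<le> ln (real (rad c))"
  proof -
    have "real (card {p\<in>?P. T \<le> p}) * ln (real T) \<le> (\<Sum>p\<in>{p\<in>?P. T \<le> p}. ln (real p))"
      using assms by (intro sum_bounded_below) auto
    also have "\<dots> \<le> (\<Sum>p\<in>?P. ln (real p))"
      by (intro sum_mono2) (force dest: prime_factors_ge_2)+
    also have "\<dots> = ln (real (rad c))"
      unfolding rad_def of_nat_prod by (intro ln_prod[symmetric]) (force dest: prime_factors_ge_2)+
    finally show ?thesis .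
  qed
  then have "real (card {p\<in>?P. T \<le> p}) \<le> ln (real (rad c)) / ln (real T)"
    using lnT by (simp add: field_simps)
  ultimately show ?thesis by linarith
qed

section \<open>From pairs to sums over \<open>{1..c}\<close>\<close>

lemma sum_abc_pairs_le:
  fixes f :: "nat \<Rightarrow> real"
  assumes "\<And>m. m \<in> {1..c} \<Longrightarrow> f m \<ge> 0"
  shows "(\<Sum>(a, b)\<in>abc_pairs c. f a + f b) \<le> (\<Sum>m=1..c. f m)"
proof -
  let ?A = "fst ` abc_pairs c" and ?B = "snd ` abc_pairs c"
  have inj: "inj_on fst (abc_pairs c)" "inj_on snd (abc_pairs c)"
    by (auto simp: abc_pairs_def inj_on_def)
  have "(\<Sum>(a, b)\<in>abc_pairs c. f a + f b)
      = (\<Sum>x\<in>abc_pairs c. f (fst x)) + (\<Sum>x\<in>abc_pairs c. f (snd x))"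
    by (simp add: case_prod_beta sum.distrib)
  also have "\<dots> = sum f ?A + sum f ?B"
    by (simp add: sum.reindex inj)
  \<comment> \<open>First components lie below \<open>c / 2\<close> and second components above
    it.\<close>
  also have "\<dots> = sum f (?A \<union> ?B)"
    by (intro sum.union_disjoint[symmetric]) (auto simp: finite_abc_pairs, auto simp: abc_pairs_def)
  also have "\<dots> \<le> (\<Sum>m=1..c. f m)"
    using assms by (intro sum_mono2) (auto simp: abc_pairs_def)
  finally show ?thesis .
qed

text \<open>In each pair \<open>a\<close>, \<open>b\<close> and \<open>c = a + b\<close> are
  pairwise coprime, so the radical splits as a product.\<close>

lemma ln_G:
  "ln (real (G c)) = (\<Sum>(a, b)\<in>abc_pairs c. ln (real (rad a)) + ln (real (rad b)) + ln (real (rad c)))"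
proof -
  have "ln (real (G c)) = (\<Sum>x\<in>abc_pairs c. ln (real (case x of (a, b) \<Rightarrow> rad (a * b * c))))"
    unfolding G_def of_nat_prod
    by (intro ln_prod) (auto simp: rad_pos finite_abc_pairs)
  also have "\<dots> = (\<Sum>(a, b)\<in>abc_pairs c. ln (real (rad a)) + ln (real (rad b)) + ln (real (rad c)))"
  proof (intro sum.cong refl, clarify)
    fix a b assume "(a, b) \<in> abc_pairs c"
    then have ab: "a > 0" "b > 0" "coprime a b" and c: "c = a + b"
      by (auto simp: abc_pairs_def)
    have "coprime a c"
      unfolding c using ab(3) by (simp only: coprime_iff_gcd_eq_1 gcd_add2)
    moreover have "coprime b c"
      unfolding c add.commute[of a b] using ab(3)
      by (simp only: coprime_iff_gcd_eq_1 gcd_add2 gcd.commute[of b a])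
    ultimately have "rad (a * b * c) = rad a * rad b * rad c"
      using ab c by (simp add: rad_mult_coprime)
    then show "ln (real (rad (a * b * c))) = ln (real (rad a)) + ln (real (rad b)) + ln (real (rad c))"
      by (simp add: ln_mult rad_pos)
  qed
  finally show ?thesis .
qed

text \<open>Each pair contributes \<open>ln (rad c) + 2 * ln c\<close> minus the defects of
  \<open>a\<close> and \<open>b\<close>; over all pairs these defects add up to at most the sum over
  \<open>{1..c}\<close>.\<close>

lemma ln_G_ge:
  assumes "c > 0" and K: "(\<Sum>m=1..c. ln (real c) - ln (real (rad m))) \<le> K * real c"
  shows "ln (real (G c)) \<ge> real (card (abc_pairs c)) * (ln (real (rad c)) + 2 * ln (real c)) - K * real c"
proof -
  define f where "f = (\<lambda>m. ln (real c) - ln (real (rad m)))"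
  have "f m \<ge> 0" if "m \<in> {1..c}" for m
    using that rad_le[of m] rad_pos[of m] by (simp add: f_def)
  then have "(\<Sum>(a, b)\<in>abc_pairs c. f a + f b) \<le> K * real c"
    using sum_abc_pairs_le[of c f] K by (simp add: f_def)
  moreover have "ln (real (G c)) = (\<Sum>(a, b)\<in>abc_pairs c. (ln (real (rad c)) + 2 * ln (real c)) - (f a + f b))"
    unfolding ln_G f_def by (intro sum.cong) auto
  then have "ln (real (G c)) = real (card (abc_pairs c)) * (ln (real (rad c)) + 2 * ln (real c))
      - (\<Sum>(a, b)\<in>abc_pairs c. f a + f b)"
    by (simp add: case_prod_beta sum_subtractf)
  ultimately show ?thesis by linarith
qed

section \<open>Choice of the constants and exponentiation\<close>

theorem theorem3:
  fixes \<epsilon> :: real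
  assumes "\<epsilon> > 0"
  shows "\<exists>k::real. k > 0 \<and>
    (\<forall>c::nat. c \<ge> 3 \<longrightarrow>
      real (G c) powr (2 / real (totient c)) > k * real (rad c) powr (1 - \<epsilon>) * real c ^ 2)"
proof -
  obtain K where K: "K \<ge> 0" "\<And>n. (\<Sum>m=1..n. ln (real n) - ln (real (rad m))) \<le> K * real n"
    using sum_rad_defect_le by blast
  \<comment> \<open>\<open>T\<close> is so large that the coefficient \<open>2 * K / ln T\<close> of
    \<open>ln (rad c)\<close> in the averaged loss is at most \<open>\<epsilon>\<close>; the maximum
    with 2 keeps \<open>ln T\<close> positive.\<close>
  define T where "T = max 2 (nat \<lceil>exp (2 * K / \<epsilon>)\<rceil>)"
  have T: "T \<ge> 2" "exp (2 * K / \<epsilon>) \<le> real T"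
    unfolding T_def by linarith+
  then have "2 * K / \<epsilon> \<le> ln (real T)"
    by (simp add: ln_ge_iff)
  with T(1) assms have KT: "2 * K / ln (real T) \<le> \<epsilon>"
    by (simp add: field_simps)
  \<comment> \<open>\<open>C\<close> collects the part of the loss that does not depend on
    \<open>c\<close>.\<close>
  define C where "C = 2 * K * (1 + real T)"
  have "exp (- C) / 2 * real (rad c) powr (1 - \<epsilon>) * real c ^ 2
      < real (G c) powr (2 / real (totient c))" if c: "c \<ge> 3" for c
  proof -
    define R where "R = real (rad c)"
    have "rad c \<ge> 1"
      using rad_pos[of c] by simp
    then have R: "R \<ge> 1" "R > 0"
      unfolding R_def by linarith+
    let ?N = "real (card (abc_pairs c))"
    have phi: "real (totient c) = 2 * ?N"
      using totient_eq_card_abc_pairs[OF c] by simp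
    moreover have "totient c > 0"
      using c by simp
    ultimately have N: "?N > 0" by linarith
    \<comment> \<open>Averaging over the pairs turns the loss \<open>K * c\<close> into
      \<open>K * c / N = 2 * K * c / totient c\<close>.\<close>
    have "real c / real (totient c) \<le> 1 + real T + ln R / ln (real T)"
      using div_totient_le[of c] card_prime_factors_le[OF T(1), of c] c by (simp add: R_def)
    then have "2 * K * (real c / real (totient c)) \<le> 2 * K * (1 + real T + ln R / ln (real T))"
      using K(1) by (intro mult_left_mono) auto
    also have "\<dots> = C + 2 * K / ln (real T) * ln R"
      by (simp add: C_def algebra_simps)
    also have "\<dots> \<le> C + \<epsilon> * ln R"
      using KT R by (intro add_left_mono mult_right_mono) auto
    finally have loss: "K * real c / ?N \<le> C + \<epsilon> * ln R"
      by (simp add: phi)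
    have "?N * (ln R + 2 * ln (real c)) - K * real c \<le> ln (real (G c))"
      using ln_G_ge[OF _ K(2)] c by (simp add: R_def)
    then have "(?N * (ln R + 2 * ln (real c)) - K * real c) / ?N \<le> ln (real (G c)) / ?N"
      using N by (intro divide_right_mono) auto
    then have "ln R + 2 * ln (real c) - K * real c / ?N \<le> ln (real (G c)) / ?N"
      using N by (simp add: diff_divide_distrib)
    with loss have main: "- C + (1 - \<epsilon>) * ln R + 2 * ln (real c) \<le> ln (real (G c)) / ?N"
      by (simp add: algebra_simps)
    have "G c > 0"
      unfolding G_def by (intro prod_pos) (auto simp: rad_pos)
    then have G: "real (G c) powr (2 / real (totient c)) = exp (ln (real (G c)) / ?N)"
      by (simp add: phi powr_def)
    \<comment> \<open>The estimate in \<open>main\<close> is not strict; halving the constant makes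
      the final inequality strict.\<close>
    have "exp (- C) / 2 * R powr (1 - \<epsilon>) * real c ^ 2 < exp (- C) * R powr (1 - \<epsilon>) * real c ^ 2"
      using R c by simp
    also have "\<dots> = exp (- C) * exp ((1 - \<epsilon>) * ln R) * exp (2 * ln (real c))"
      using R c by (simp add: powr_def exp_double)
    also have "\<dots> = exp (- C + (1 - \<epsilon>) * ln R + 2 * ln (real c))"
      by (simp only: exp_add)
    also have "\<dots> \<le> exp (ln (real (G c)) / ?N)"
      using main by simp
    finally show ?thesis
      by (simp only: G R_def)
  qed
  then show ?thesis
    by (intro exI[of _ "exp (- C) / 2"]) auto
qed

end
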